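(* Assume that the smoothing error operators $S_k$ and the numbers of smoothing steps $m_k$ satisfy the following, for $k=1,\dots,J$. (i) $S_k$ is symmetric positive semidefinite on $V_k$ with respect to $a(\cdot,\cdot)$: $a(S_kv,w)=a(v,S_kw)$ and $a(S_kv,v)\ge 0$ for all $v,w\in V_k$. (ii) There is a number $\delta_k$ with $0<\delta_k<1$ such that $a(S_kv,v)\le \delta_k\,a(v,v)$ for all $v\in V_k$. (iii) The finite sequence $\psi_k=m_k(1-\delta_k)$, $k=1,\dots,J$, is non-increasing in $k$. For $k=1,\dots,J$ let $$\gamma_k=\frac{1}{1+2\,m_k(1-\delta_k)}.$$ Then the multigrid error operator $E_J$ satisfies $$a(E_Jv,v)\le \gamma_J\,a(v,v)\qquad\text{for all } v\in V_J.$$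
   Context: Let $J\ge 1$ and let $V_0\subset V_1\subset\dots\subset V_J$ be finite-dimensional real vector spaces. Let $(\cdot,\cdot)$ and $a(\cdot,\cdot)$ be two symmetric positive definite bilinear forms on $V_J$ (hence on each $V_k$). Let $P_k:V_J\to V_k$ be the $a$-orthogonal projection: $a(P_kv,w)=a(v,w)$ for all $v\in V_J$, $w\in V_k$. Let $A_k:V_k\to V_k$ be given by $(A_ku,v)=a(u,v)$ for all $u,v\in V_k$. For each $k$ let $B_k:V_k\to V_k$ be a linear smoothing operator and let $S_k=I-B_kA_k:V_k\to V_k$ be the associated smoothing error operator. Let $m_k\ge 1$ be the (integer) number of pre-smoothing steps at level $k$, equal to the number of post-smoothing steps. The multigrid error operators $E_k:V_k\to V_k$ (the error operators of the symmetric V-cycle with an exact solve at level $0$) are defined recursively by $$E_0=0,\qquad E_k=S_k^{m_k}\big[I-(I-E_{k-1})P_{k-1}\big]S_k^{m_k},\quad k=1,\dots,J.$$ *)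

theory Defs
  imports "HOL-Analysis.Analysis"
begin

text \<open>
  The spaces \<open>V k\<close> are subspaces of an ambient real vector space, given as sets. Operators and
  bilinear forms on a subspace are total functions of which only the values on that subspace matter.
\<close>

definition findim_subspace :: "'a::real_vector set \<Rightarrow> bool" where
  "findim_subspace W \<longleftrightarrow> subspace W \<and> (\<exists>B. finite B \<and> span B = W)"

definition linear_map_on :: "'a::real_vector set \<Rightarrow> ('a \<Rightarrow> 'b::real_vector) \<Rightarrow> bool" where
  "linear_map_on W f \<longleftrightarrow>
     (\<forall>u\<in>W. \<forall>v\<in>W. f (u + v) = f u + f v) \<and> (\<forall>c. \<forall>v\<in>W. f (c *\<^sub>R v) = c *\<^sub>R f v)"

definition linear_operator_on :: "'a::real_vector set \<Rightarrow> ('a \<Rightarrow> 'a) \<Rightarrow> bool" where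
  "linear_operator_on W T \<longleftrightarrow> linear_map_on W T \<and> (\<forall>v\<in>W. T v \<in> W)"

definition spd_form_on :: "'a::real_vector set \<Rightarrow> ('a \<Rightarrow> 'a \<Rightarrow> real) \<Rightarrow> bool" where
  "spd_form_on W b \<longleftrightarrow>
     (\<forall>u\<in>W. linear_map_on W (\<lambda>v. b u v)) \<and> (\<forall>v\<in>W. linear_map_on W (\<lambda>u. b u v)) \<and>
     (\<forall>u\<in>W. \<forall>v\<in>W. b u v = b v u) \<and> (\<forall>v\<in>W. v \<noteq> 0 \<longrightarrow> 0 < b v v)"

text \<open>
  The projection \<open>P\<^sub>k\<close> is \<open>form_projection a (V k)\<close>, and \<open>A\<^sub>k\<close> is \<open>form_operator ip a (V k)\<close>, where
  \<open>ip\<close> is the form \<open>(\<cdot>, \<cdot>)\<close>. That the descriptions below are well defined is proved in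
  \<open>form_projection_ex1\<close> and \<open>form_operator_ex1\<close>.
\<close>

definition form_projection ::
    "('a::real_vector \<Rightarrow> 'a \<Rightarrow> real) \<Rightarrow> 'a set \<Rightarrow> 'a \<Rightarrow> 'a" where
  "form_projection a W v = (THE p. p \<in> W \<and> (\<forall>w\<in>W. a p w = a v w))"

definition form_operator ::
    "('a::real_vector \<Rightarrow> 'a \<Rightarrow> real) \<Rightarrow> ('a \<Rightarrow> 'a \<Rightarrow> real) \<Rightarrow> 'a set \<Rightarrow> 'a \<Rightarrow> 'a" where
  "form_operator ip a W u = (THE r. r \<in> W \<and> (\<forall>v\<in>W. ip r v = a u v))"

definition smoothing_error ::
    "('a::real_vector \<Rightarrow> 'a \<Rightarrow> real) \<Rightarrow> ('a \<Rightarrow> 'a \<Rightarrow> real) \<Rightarrow> (nat \<Rightarrow> 'a set) \<Rightarrow>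
     (nat \<Rightarrow> 'a \<Rightarrow> 'a) \<Rightarrow> nat \<Rightarrow> 'a \<Rightarrow> 'a" where
  "smoothing_error ip a V B k v = v - B k (form_operator ip a (V k) v)"

primrec multigrid_error ::
    "('a::real_vector \<Rightarrow> 'a \<Rightarrow> real) \<Rightarrow> (nat \<Rightarrow> 'a set) \<Rightarrow> (nat \<Rightarrow> 'a \<Rightarrow> 'a) \<Rightarrow>
     (nat \<Rightarrow> nat) \<Rightarrow> nat \<Rightarrow> 'a \<Rightarrow> 'a" where
  "multigrid_error a V S m 0 = (\<lambda>v. 0)"
| "multigrid_error a V S m (Suc k) =
     (S (Suc k) ^^ m (Suc k)) \<circ>
     (\<lambda>w. w - (form_projection a (V k) w
                - multigrid_error a V S m k (form_projection a (V k) w))) \<circ>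
     (S (Suc k) ^^ m (Suc k))"

lemma linear_map_on_subset: "linear_map_on W f \<Longrightarrow> U \<subseteq> W \<Longrightarrow> linear_map_on U f"
  unfolding linear_map_on_def by blast

lemma spd_form_on_subset:
  assumes "spd_form_on W b" "U \<subseteq> W"
  shows "spd_form_on U b"
proof -
  have "\<forall>u\<in>U. linear_map_on U (\<lambda>v. b u v)" "\<forall>v\<in>U. linear_map_on U (\<lambda>u. b u v)"
    using assms linear_map_on_subset[OF _ assms(2)] unfolding spd_form_on_def by (metis subsetD)+
  moreover have "\<forall>u\<in>U. \<forall>v\<in>U. b u v = b v u" "\<forall>v\<in>U. v \<noteq> 0 \<longrightarrow> 0 < b v v"
    using assms unfolding spd_form_on_def by (metis subsetD)+
  ultimately show ?thesis unfolding spd_form_on_def by (intro conjI)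
qed

lemma spd_form_on_linear:
  assumes "spd_form_on W b" "u \<in> W"
  shows "linear_map_on W (b u)"
  by (rule bspec[OF conjunct1[OF assms(1)[unfolded spd_form_on_def]] assms(2)])

lemma spd_form_on_simps:
  assumes "spd_form_on W b" "u \<in> W" "v \<in> W" "w \<in> W"
  shows "b (u + v) w = b u w + b v w" "b w (u + v) = b w u + b w v"
    "b (c *\<^sub>R u) w = c * b u w" "b w (c *\<^sub>R u) = c * b w u"
    "b u v = b v u" "u \<noteq> 0 \<Longrightarrow> 0 < b u u"
proof -
  have l: "linear_map_on W (b w)" by (rule spd_form_on_linear[OF assms(1,4)])
  have r: "linear_map_on W (\<lambda>u. b u w)"
    by (rule bspec[OF conjunct1[OF conjunct2[OF assms(1)[unfolded spd_form_on_def]]] assms(4)])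
  show "b (u + v) w = b u w + b v w" "b (c *\<^sub>R u) w = c * b u w"
    using r assms(2,3) by (simp_all add: linear_map_on_def)
  show "b w (u + v) = b w u + b w v" "b w (c *\<^sub>R u) = c * b w u"
    using l assms(2,3) by (simp_all add: linear_map_on_def)
  show "b u v = b v u" "u \<noteq> 0 \<Longrightarrow> 0 < b u u"
    using assms(1-3) unfolding spd_form_on_def by metis+
qed

lemma riesz_exists:
  assumes "finite B" "span B \<subseteq> W" "spd_form_on W b" "linear_map_on W f"
  shows "\<exists>w\<in>span B. \<forall>v\<in>span B. b w v = f v"
  using assms(1,2,4)
proof (induction B arbitrary: f rule: finite_induct)
  case empty
  then have W0: "0 \<in> W" by simp
  have "b 0 0 = 0" using spd_form_on_simps(3)[OF assms(3) W0 W0 W0, of 0] by simp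
  moreover have "f (0 *\<^sub>R 0) = 0 *\<^sub>R f 0"
    using empty.prems(2) W0 unfolding linear_map_on_def by blast
  then have "f 0 = 0" by simp
  ultimately show ?case by simp
next
  case (insert x B f)
  have sub: "span B \<subseteq> span (insert x B)" by (simp add: span_mono subset_insertI)
  have subW: "span B \<subseteq> W" using sub insert.prems by blast
  have xW: "x \<in> W" using insert.prems span_base by blast
  have "linear_map_on W (b x)" by (rule spd_form_on_linear[OF assms(3) xW])
  from insert.IH[OF subW this] obtain p
    where p: "p \<in> span B" "\<And>v. v \<in> span B \<Longrightarrow> b p v = b x v" by auto
  from insert.IH[OF subW insert.prems(2)] obtain w0
    where w0: "w0 \<in> span B" "\<And>v. v \<in> span B \<Longrightarrow> b w0 v = f v" by auto
  show ?case
  proof (cases "x \<in> span B")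
    case True
    then show ?thesis using w0 by (auto simp: span_redundant)
  next
    case False
    define y where "y = x - p"
    have ys: "y \<in> span (insert x B)"
      unfolding y_def using p sub by (intro span_diff) (auto intro: span_base)
    then have yW: "y \<in> W" using insert.prems by blast
    have y0: "y \<noteq> 0" using False p(1) y_def by auto
    then have byy: "b y y > 0" using spd_form_on_simps(6)[OF assms(3) yW yW yW] by simp
    have orth: "b y v = 0" if "v \<in> span B" for v
    proof -
      have "b (p + y) v = b p v + b y v"
        using spd_form_on_simps(1)[OF assms(3), of p y v] p that subW yW by auto
      then show ?thesis using p(2)[OF that] by (simp add: y_def)
    qed
    define t where "t = f y / b y y"
    define w where "w = w0 + t *\<^sub>R y"
    have "w \<in> span (insert x B)"
      unfolding w_def using w0 sub ys by (intro span_add span_scale) auto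
    moreover have "b w v = f v" if v: "v \<in> span (insert x B)" for v
    proof -
      obtain c where c: "v - c *\<^sub>R x \<in> span B" using v by (auto simp: span_insert)
      define u where "u = v - c *\<^sub>R y"
      have "u = (v - c *\<^sub>R x) + c *\<^sub>R p" by (simp add: u_def y_def algebra_simps)
      then have u: "u \<in> span B" using c p by (simp add: span_add span_scale)
      have veq: "v = u + c *\<^sub>R y" by (simp add: u_def)
      have W: "u \<in> W" "w0 \<in> W" "c *\<^sub>R y \<in> W" "t *\<^sub>R y \<in> W" "v \<in> W"
        using u w0(1) subW span_scale[OF ys] insert.prems(1) v by auto
      note s = spd_form_on_simps[OF assms(3)]
      have "b w v = b w0 v + t * b y v"
        unfolding w_def using s(1)[OF W(2) W(4) W(5)] s(3)[OF yW yW W(5)] by simp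
      also have "b w0 v = f u + c * b w0 y"
        unfolding veq using s(2)[OF W(1) W(3) W(2)] s(4)[OF yW yW W(2)] w0(2)[OF u] by simp
      also have "b w0 y = 0" using s(5)[OF W(2) yW yW] orth[OF w0(1)] by simp
      also have "b y v = c * b y y"
        unfolding veq using s(2)[OF W(1) W(3) yW] s(4)[OF yW yW yW] orth[OF u] by simp
      finally have "b w v = f u + c * f y" using byy by (simp add: t_def)
      also have "\<dots> = f v"
        unfolding veq using insert.prems(2) W(1,3) yW unfolding linear_map_on_def by simp
      finally show ?thesis .
    qed
    ultimately show ?thesis by blast
  qed
qed

lemma riesz_ex1:
  assumes "findim_subspace W" "spd_form_on W b" "linear_map_on W f"
  shows "\<exists>!w. w \<in> W \<and> (\<forall>v\<in>W. b w v = f v)"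
proof -
  obtain B where B: "finite B" "span B = W" and W: "subspace W"
    using assms(1) unfolding findim_subspace_def by blast
  obtain w where w: "w \<in> W" "\<And>v. v \<in> W \<Longrightarrow> b w v = f v"
    using riesz_exists[OF B(1) _ assms(2,3)] B(2) by blast
  show ?thesis
  proof (rule ex1I[of _ w])
    show "w \<in> W \<and> (\<forall>v\<in>W. b w v = f v)" using w by blast
  next
    fix u assume u: "u \<in> W \<and> (\<forall>v\<in>W. b u v = f v)"
    show "u = w"
    proof (rule ccontr)
      assume "u \<noteq> w"
      have d: "u - w \<in> W" using W u w(1) by (simp add: subspace_diff)
      have "b u (u - w) = b (u - w) (u - w) + b w (u - w)"
        using spd_form_on_simps(1)[OF assms(2) d w(1) d] by simp
      moreover have "b u (u - w) = f (u - w)" using u d by blast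
      ultimately have "b (u - w) (u - w) = 0" using w(2)[OF d] by simp
      then show False using spd_form_on_simps(6)[OF assms(2) d d d] \<open>u \<noteq> w\<close> by simp
    qed
  qed
qed

lemma form_projection_ex1:
  assumes "findim_subspace W" "W \<subseteq> U" "spd_form_on U a" "v \<in> U"
  shows "\<exists>!p. p \<in> W \<and> (\<forall>w\<in>W. a p w = a v w)"
  by (rule riesz_ex1[OF assms(1) spd_form_on_subset[OF assms(3,2)]
      linear_map_on_subset[OF spd_form_on_linear[OF assms(3,4)] assms(2)]])

lemma form_operator_ex1:
  assumes "findim_subspace W" "spd_form_on W ip" "spd_form_on W a" "u \<in> W"
  shows "\<exists>!r. r \<in> W \<and> (\<forall>v\<in>W. ip r v = a u v)"
  by (rule riesz_ex1[OF assms(1,2) spd_form_on_linear[OF assms(3,4)]])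

end

theory Submission
  imports Defs
begin

text \<open>
  Let \<open>w = S\<^sub>k\<^bsup>m\<^esup> v\<close> be the presmoothed error. Symmetry of \<open>S\<^sub>k\<close> and of the projection turns
  \<open>a (E\<^sub>k v) v\<close> into \<open>a w w - a p p + a (E\<^sub>k\<^sub>-\<^sub>1 p) p\<close> with \<open>p = P\<^sub>k\<^sub>-\<^sub>1 w\<close>, which is at most \<open>a w w\<close> as
  soon as \<open>E\<^sub>k\<^sub>-\<^sub>1\<close> is bounded by the identity. The spectral bound on \<open>S\<^sub>k\<close> then gives the
  factor \<open>\<delta>\<^sub>k\<^bsup>2 m\<^esup>\<close>, and Bernoulli's inequality for \<open>(1 / \<delta>\<^sub>k)\<^bsup>2 m\<^esup>\<close> bounds it by \<open>\<gamma>\<^sub>k\<close>.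
\<close>

lemma spd_form_on_nonneg:
  assumes "spd_form_on W a" "v \<in> W"
  shows "0 \<le> a v v"
proof (cases "v = 0")
  case True
  then show ?thesis using spd_form_on_simps(3)[OF assms(1) assms(2,2,2), of 0] by simp
next
  case False
  then show ?thesis using spd_form_on_simps(6)[OF assms(1) assms(2,2,2)] by simp
qed

lemma spd_form_on_diff:
  assumes "subspace W" "spd_form_on W a" "u \<in> W" "v \<in> W" "w \<in> W"
  shows "a (u - v) w = a u w - a v w" "a w (u - v) = a w u - a w v"
proof -
  have "u - v \<in> W" using assms by (simp add: subspace_diff)
  then show "a (u - v) w = a u w - a v w" "a w (u - v) = a w u - a w v"
    using spd_form_on_simps(1,2)[OF assms(2), of "u - v" v w] assms(4,5) by simp_all
qed

text \<open>An algebraic substitute for the spectral theorem. Positivity of \<open>T\<close> at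
  \<open>x = d *\<^sub>R v - T v\<close> says that \<open>T (d - T)^2\<close> is positive
  semidefinite, that is, \<open>2 d T^2 \<le> d^2 T + T^3\<close> as forms. Using
  \<open>T \<le> d\<close> at \<open>v\<close> and at \<open>T v\<close> turns the right side into
  \<open>d^3 + d T^2\<close>; one factor \<open>d\<close> then cancels. Bounding the norm of
  \<open>T v\<close>, rather than \<open>a (T v) v\<close>, makes the estimate iterable.\<close>

lemma spd_form_on_operator_bound:
  assumes W: "subspace W" and a: "spd_form_on W a"
    and T: "\<And>v. v \<in> W \<Longrightarrow> T v \<in> W"
    and sym: "\<And>v w. v \<in> W \<Longrightarrow> w \<in> W \<Longrightarrow> a (T v) w = a v (T w)"
    and pos: "\<And>v. v \<in> W \<Longrightarrow> 0 \<le> a (T v) v"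
    and le: "\<And>v. v \<in> W \<Longrightarrow> a (T v) v \<le> d * a v v"
    and d: "0 < d" and v: "v \<in> W"
  shows "a (T v) (T v) \<le> d\<^sup>2 * a v v"
proof -
  define x where "x = d *\<^sub>R v - T v"
  have Tv: "T v \<in> W" "T (T v) \<in> W" "d *\<^sub>R v \<in> W" using T v W by (auto simp: subspace_scale)
  have x: "x \<in> W" unfolding x_def using Tv W by (simp add: subspace_diff)
  have split: "a x y = d * a v y - a (T v) y" if "y \<in> W" for y
    unfolding x_def using spd_form_on_diff(1)[OF W a Tv(3,1) that]
      spd_form_on_simps(3)[OF a v v that] by simp
  have "a (T x) x = d * a (T x) v - a (T x) (T v)"
    using spd_form_on_diff(2)[OF W a Tv(3,1) T[OF x]] spd_form_on_simps(4)[OF a v v T[OF x]]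
    by (simp add: x_def)
  also have "\<dots> = d * a x (T v) - a x (T (T v))" using sym x v Tv by simp
  also have "\<dots> = d * (d * a v (T v) - a (T v) (T v)) - (d * a v (T (T v)) - a (T v) (T (T v)))"
    using split Tv by simp
  also have "\<dots> = d\<^sup>2 * a (T v) v - 2 * d * a (T v) (T v) + a (T (T v)) (T v)"
    using sym[OF v v] sym[OF v Tv(1)] sym[OF Tv(1,1)] by (simp add: power2_eq_square algebra_simps)
  finally have "2 * d * a (T v) (T v) \<le> d\<^sup>2 * a (T v) v + a (T (T v)) (T v)"
    using pos[OF x] by simp
  also have "\<dots> \<le> d\<^sup>2 * (d * a v v) + d * a (T v) (T v)"
    by (intro add_mono mult_left_mono le v Tv) simp
  finally have "d * a (T v) (T v) \<le> d * (d\<^sup>2 * a v v)" by (simp add: algebra_simps)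
  then show ?thesis using d by simp
qed

lemma funpow_closed:
  assumes "\<And>v. v \<in> W \<Longrightarrow> T v \<in> W" "v \<in> W"
  shows "(T ^^ n) v \<in> W"
  using assms by (induction n) auto

lemma funpow_symmetric:
  assumes T: "\<And>v. v \<in> W \<Longrightarrow> T v \<in> W"
    and sym: "\<And>v w. v \<in> W \<Longrightarrow> w \<in> W \<Longrightarrow> a (T v) w = a v (T w)"
    and "v \<in> W" "w \<in> W"
  shows "a ((T ^^ n) v) w = a v ((T ^^ n) w)"
  using assms(3,4)
\<comment> \<open>The outermost \<open>T\<close> moves to the other argument first, so the induction
  hypothesis is applied at \<open>T w\<close>.\<close>
proof (induction n arbitrary: w)
  case (Suc n)
  have "a ((T ^^ Suc n) v) w = a ((T ^^ n) v) (T w)"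
    using sym Suc.prems funpow_closed[where W = W, OF T] by simp
  also have "\<dots> = a v ((T ^^ n) (T w))" using Suc T by blast
  finally show ?case by (simp add: funpow_swap1)
qed simp

lemma funpow_form_bound:
  fixes c :: real
  assumes T: "\<And>v. v \<in> W \<Longrightarrow> T v \<in> W"
    and le: "\<And>v. v \<in> W \<Longrightarrow> a (T v) (T v) \<le> c * a v v"
    and c: "0 \<le> c" and v: "v \<in> W"
  shows "a ((T ^^ n) v) ((T ^^ n) v) \<le> c ^ n * a v v"
proof (induction n)
  case (Suc n)
  have "a ((T ^^ Suc n) v) ((T ^^ Suc n) v) \<le> c * a ((T ^^ n) v) ((T ^^ n) v)"
    using le funpow_closed[where W = W, OF T v] by simp
  also have "\<dots> \<le> c * (c ^ n * a v v)" using Suc c by (rule mult_left_mono)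
  finally show ?case by simp
qed simp

text \<open>\<open>F\<close> stands for the error operator of the next coarser level. Testing the
  defining property of \<open>p\<close> with the elements \<open>p\<close> and \<open>F p\<close> of
  \<open>U\<close> reduces the form to \<open>a w w - (a p p - a (F p) p)\<close>, whose bracket is
  nonnegative.\<close>

lemma coarse_correction:
  assumes U: "findim_subspace U" "U \<subseteq> W" and W: "subspace W" and a: "spd_form_on W a"
    and F: "\<And>u. u \<in> U \<Longrightarrow> F u \<in> U" "\<And>u. u \<in> U \<Longrightarrow> a (F u) u \<le> a u u"
    and w: "w \<in> W"
  defines "p \<equiv> form_projection a U w"
  shows "w - (p - F p) \<in> W" "a (w - (p - F p)) w \<le> a w w"
proof -
  have p: "p \<in> U" "\<And>u. u \<in> U \<Longrightarrow> a p u = a w u"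
    using theI'[OF form_projection_ex1[OF U a w]] by (auto simp: p_def form_projection_def)
  note FU = F(1)[OF p(1)]
  have pW: "p \<in> W" "F p \<in> W" using p FU U by auto
  then have qW: "p - F p \<in> W" using W by (simp add: subspace_diff)
  then show "w - (p - F p) \<in> W" using W w by (simp add: subspace_diff)
  have "a (w - (p - F p)) w = a w w - (a p w - a (F p) w)"
    using spd_form_on_diff(1)[OF W a w qW w] spd_form_on_diff(1)[OF W a pW w] by simp
  also have "a p w = a p p"
    using spd_form_on_simps(5)[OF a pW(1) w w] p(2)[OF p(1)] by simp
  also have "a (F p) w = a (F p) p"
    using spd_form_on_simps(5)[OF a pW(2) w w] spd_form_on_simps(5)[OF a pW(2,1) w] p(2)[OF FU]
    by simp
  finally show "a (w - (p - F p)) w \<le> a w w" using F(2)[OF p(1)] by simp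
qed

lemma smoothing_error_closed:
  assumes V: "findim_subspace (V k)" "spd_form_on (V k) ip" "spd_form_on (V k) a"
    and B: "linear_operator_on (V k) (B k)" and v: "v \<in> V k"
  shows "smoothing_error ip a V B k v \<in> V k"
proof -
  have "form_operator ip a (V k) v \<in> V k"
    using theI'[OF form_operator_ex1[OF V v]] by (simp add: form_operator_def)
  then show ?thesis
    using V(1) B v
    by (auto simp: smoothing_error_def linear_operator_on_def findim_subspace_def
        intro: subspace_diff)
qed

text \<open>The whole contraction factor comes from smoothing on the finer level; the coarser level
  contributes only its bound by the identity.\<close>

lemma multigrid_error_Suc_bound:
  assumes V: "findim_subspace (V k)" "V k \<subseteq> V (Suc k)" "subspace (V (Suc k))"
      "spd_form_on (V (Suc k)) a"
    and S: "\<And>v. v \<in> V (Suc k) \<Longrightarrow> S (Suc k) v \<in> V (Suc k)"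
    and sym: "\<And>v w. v \<in> V (Suc k) \<Longrightarrow> w \<in> V (Suc k) \<Longrightarrow> a (S (Suc k) v) w = a v (S (Suc k) w)"
    and pos: "\<And>v. v \<in> V (Suc k) \<Longrightarrow> 0 \<le> a (S (Suc k) v) v"
    and le: "\<And>v. v \<in> V (Suc k) \<Longrightarrow> a (S (Suc k) v) v \<le> d * a v v" and d: "0 < d"
    and E: "\<And>v. v \<in> V k \<Longrightarrow> multigrid_error a V S m k v \<in> V k"
      "\<And>v. v \<in> V k \<Longrightarrow> a (multigrid_error a V S m k v) v \<le> a v v"
    and v: "v \<in> V (Suc k)"
  shows "multigrid_error a V S m (Suc k) v \<in> V (Suc k)"
    "a (multigrid_error a V S m (Suc k) v) v \<le> d ^ (2 * m (Suc k)) * a v v"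
proof -
  define w where "w = (S (Suc k) ^^ m (Suc k)) v"
  define p where "p = form_projection a (V k) w"
  define z where "z = w - (p - multigrid_error a V S m k p)"
  have w: "w \<in> V (Suc k)" unfolding w_def by (rule funpow_closed[where W = "V (Suc k)", OF S v])
  have z: "z \<in> V (Suc k)" "a z w \<le> a w w"
    unfolding z_def p_def
    using coarse_correction[where F = "multigrid_error a V S m k" and a = a, OF V E w] by simp_all
  have eq: "multigrid_error a V S m (Suc k) v = (S (Suc k) ^^ m (Suc k)) z"
    by (simp add: z_def p_def w_def)
  show "multigrid_error a V S m (Suc k) v \<in> V (Suc k)"
    unfolding eq by (rule funpow_closed[where W = "V (Suc k)", OF S z(1)])
  \<comment> \<open>Postsmoothing is moved onto the second argument, where it acts as a second
    presmoothing of \<open>v\<close>.\<close>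
  have "a (multigrid_error a V S m (Suc k) v) v = a z w"
    unfolding eq w_def by (rule funpow_symmetric[where W = "V (Suc k)" and a = a, OF S sym z(1) v])
  also have "\<dots> \<le> a w w" by (rule z)
  \<comment> \<open>Each sweep scales the squared \<open>a\<close>-norm by at most
    \<open>d\<^sup>2\<close>, whence the exponent \<open>2 * m (Suc k)\<close>.\<close>
  also have "\<dots> \<le> (d\<^sup>2) ^ m (Suc k) * a v v"
    unfolding w_def
    by (rule funpow_form_bound[where W = "V (Suc k)" and a = a])
      (use S v spd_form_on_operator_bound[where T = "S (Suc k)" and a = a and d = d, OF V(3,4) S sym pos le d]
        in auto)
  finally show "a (multigrid_error a V S m (Suc k) v) v \<le> d ^ (2 * m (Suc k)) * a v v"
    by (simp add: power_mult)
qed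

text \<open>Bernoulli's inequality is applied to \<open>1 / d = 1 + (1 / d - 1)\<close>, and
  \<open>1 / d - 1\<close> dominates \<open>1 - d\<close> because \<open>d + 1 / d\<close> is at
  least 2. The case \<open>n = 2 * m k\<close> produces \<open>\<gamma> k\<close>.\<close>

lemma power_le_inverse_Bernoulli:
  fixes d :: real
  assumes "0 < d" "d \<le> 1"
  shows "d ^ n \<le> 1 / (1 + n * (1 - d))"
proof -
  have "0 \<le> (1 - d)\<^sup>2" by simp
  then have "1 - d \<le> 1 / d - 1" using assms by (simp add: field_simps power2_eq_square)
  then have "1 + n * (1 - d) \<le> 1 + n * (1 / d - 1)" by (simp add: mult_left_mono)
  also have "\<dots> \<le> (1 + (1 / d - 1)) ^ n" using assms by (intro Bernoulli_inequality) simp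
  also have "\<dots> = 1 / d ^ n" by (simp add: power_one_over)
  finally have "(1 + n * (1 - d)) * d ^ n \<le> 1" using assms by (simp add: pos_le_divide_eq)
  moreover have "0 < 1 + n * (1 - d)" using assms by (simp add: add_pos_nonneg)
  ultimately show ?thesis by (simp add: pos_le_divide_eq mult.commute)
qed

theorem theorem1:
  fixes V :: "nat \<Rightarrow> 'a::real_vector set"
    and ip a :: "'a \<Rightarrow> 'a \<Rightarrow> real"
    and B S E :: "nat \<Rightarrow> 'a \<Rightarrow> 'a"
    and m :: "nat \<Rightarrow> nat"
    and \<delta> \<gamma> :: "nat \<Rightarrow> real"
    and J :: nat
  defines "S \<equiv> smoothing_error ip a V B"
    and "E \<equiv> multigrid_error a V S m"
    and "\<gamma> \<equiv> (\<lambda>k. 1 / (1 + 2 * real (m k) * (1 - \<delta> k)))"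
  assumes "1 \<le> J"
    and "\<And>k. k \<le> J \<Longrightarrow> findim_subspace (V k)"
    and "\<And>k. k < J \<Longrightarrow> V k \<subseteq> V (Suc k)"
    and "spd_form_on (V J) ip"
    and "spd_form_on (V J) a"
    and "\<And>k. k \<in> {1..J} \<Longrightarrow> linear_operator_on (V k) (B k)"
    and "\<And>k. k \<in> {1..J} \<Longrightarrow> 1 \<le> m k"
    and "\<And>k v w. k \<in> {1..J} \<Longrightarrow> v \<in> V k \<Longrightarrow> w \<in> V k \<Longrightarrow> a (S k v) w = a v (S k w)"
    and "\<And>k v. k \<in> {1..J} \<Longrightarrow> v \<in> V k \<Longrightarrow> 0 \<le> a (S k v) v"
    and "\<And>k. k \<in> {1..J} \<Longrightarrow> 0 < \<delta> k \<and> \<delta> k < 1"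
    and "\<And>k v. k \<in> {1..J} \<Longrightarrow> v \<in> V k \<Longrightarrow> a (S k v) v \<le> \<delta> k * a v v"
    and "antimono_on {1..J} (\<lambda>k. real (m k) * (1 - \<delta> k))"
  shows "\<forall>v\<in>V J. a (E J v) v \<le> \<gamma> J * a v v"
proof -
  \<comment> \<open>Downward induction from \<open>J\<close>, since inclusions are given between
    neighbouring levels.\<close>
  have nested: "V k \<subseteq> V J" if "k \<le> J" for k
    using that by (induction rule: inc_induct) (use assms(6) in auto)
  have spd: "spd_form_on (V k) ip" "spd_form_on (V k) a" if "k \<le> J" for k
    using spd_form_on_subset nested[OF that] assms(7,8) by blast+
  have S: "S k v \<in> V k" if "k \<in> {1..J}" "v \<in> V k" for k v
    unfolding S_def
    by (rule smoothing_error_closed) (use that assms(5,9) spd in auto)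
  \<comment> \<open>The bound on level \<open>k\<close> is kept as a premise, so that this step
    serves both the induction below and the final estimate with its sharper factor.\<close>
  have step: "E (Suc k) v \<in> V (Suc k) \<and>
      a (E (Suc k) v) v \<le> \<delta> (Suc k) ^ (2 * m (Suc k)) * a v v"
    if k: "k < J" and IH: "\<And>v. v \<in> V k \<Longrightarrow> E k v \<in> V k \<and> a (E k v) v \<le> a v v"
      and v: "v \<in> V (Suc k)" for k v
  proof -
    have K: "Suc k \<in> {1..J}" using k by simp
    have sub: "subspace (V (Suc k))" using assms(5)[of "Suc k"] k by (simp add: findim_subspace_def)
    have IH': "\<And>v. v \<in> V k \<Longrightarrow> multigrid_error a V S m k v \<in> V k"
        "\<And>v. v \<in> V k \<Longrightarrow> a (multigrid_error a V S m k v) v \<le> a v v"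
      and d: "0 < \<delta> (Suc k)" and J: "k \<le> J" "Suc k \<le> J"
      using IH assms(13)[OF K] k by (auto simp: E_def)
    show ?thesis unfolding E_def
      using multigrid_error_Suc_bound[where V = V and k = k and a = a and S = S
          and d = "\<delta> (Suc k)" and m = m,
          OF assms(5)[OF J(1)] assms(6)[OF k] sub spd(2)[OF J(2)] S[OF K] assms(11)[OF K]
            assms(12)[OF K] assms(14)[OF K] d IH' v] by blast
  qed
  have invariant: "E k v \<in> V k \<and> a (E k v) v \<le> a v v" if "k \<le> J" "v \<in> V k" for k v
    using that
  proof (induction k arbitrary: v)
    case 0
    have "subspace (V 0)" using assms(5)[of 0] by (simp add: findim_subspace_def)
    then have "0 \<in> V 0" by (rule subspace_0)
    moreover have "a 0 v = 0"
      using spd_form_on_simps(3)[OF spd(2)[of 0] 0(2,2,2), of 0] by simp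
    ultimately show ?case
      using spd_form_on_nonneg[OF spd(2)[of 0] 0(2)] by (simp add: E_def)
  next
    case (Suc k)
    \<comment> \<open>The contraction factor is weakened to 1, which is all that the next level asks
      for.\<close>
    have "\<delta> (Suc k) ^ (2 * m (Suc k)) \<le> 1"
      using assms(13)[of "Suc k"] Suc.prems(1) by (intro power_le_one) auto
    then have "\<delta> (Suc k) ^ (2 * m (Suc k)) * a v v \<le> a v v"
      using mult_right_mono[OF _ spd_form_on_nonneg[OF spd(2)[OF Suc.prems(1)] Suc.prems(2)]]
      by fastforce
    then show ?case using step[of k v] Suc by fastforce
  qed
  show ?thesis
  proof
    fix v assume v: "v \<in> V J"
    \<comment> \<open>The invariant is taken one level below \<open>J\<close>; one more step then
      retains the factor \<open>\<delta> J ^ (2 * m J)\<close>.\<close>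
    obtain j where J: "J = Suc j" using assms(4) by (cases J) auto
    have "a (E J v) v \<le> \<delta> J ^ (2 * m J) * a v v" using step[of j v] invariant[of j] v J by auto
    also have "\<dots> \<le> \<gamma> J * a v v"
      using power_le_inverse_Bernoulli[of "\<delta> J" "2 * m J"] assms(4,13)
        spd_form_on_nonneg[OF assms(8) v]
      by (intro mult_right_mono) (auto simp: \<gamma>_def less_imp_le)
    finally show "a (E J v) v \<le> \<gamma> J * a v v" .
  qed
qed

end
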